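(* For every instance $\mathbb I=(\mathcal M_1,\dots,\mathcal M_n,\mathcal F)$ of matroid-max-CICS, $$\mathrm{OPT}(\mathbb I)\ \le\ \mathbb E\Big[\max_{S\in\mathcal F}\sum_{i\in S}W^*_{\mathcal M_i}\Big],$$ where $W^*_{\mathcal M_1},\dots,W^*_{\mathcal M_n}$ are mutually independent water draining surrogate values.
   Context: A costly information MDP is $\mathcal M=(S,\sigma,A,c,\mathcal D,V,T)$: a finite state set $S$, start state $\sigma$, terminal states $T\subseteq S$, for each nonterminal $s$ a finite nonempty action set $A(s)$, each action $a$ with cost $c(a)\ge0$ and transition distribution $\mathcal D(s,a,\cdot)$; $V(s)$ is the conditional distribution of an underlying nonnegative random variable given state $s$, $v(s)=\mathbb E[V(s)]$. At a terminal state the only action is "accept" (cost $0$, yields value $v(t)$, ends the process). The transition graph is acyclic and every sequence of $H$ actions (fixed $H$) reaches a terminal state. Matroid-max-CICS: $n$ independently evolving costly information MDPs and a matroid on $[n]$ with independent sets $\mathcal F$. A policy adaptively picks at each step an unaccepted MDP $i$ and an action in its current state, paying its cost; it may accept a terminal state of $\mathcal M_i$ (collecting its value) only if the accepted set $S$ satisfies $S\cup\{i\}\in\mathcal F$; it may stop any time. Utility = collected values minus action costs; $\mathrm{OPT}(\mathbb I)$ = maximum expected utility. For $y\in\mathbb R$, in the local game $(\mathcal M,y)$ a policy advances $\mathcal M$ (paying costs) and finally collects either an outside option of value $y$ or the value of a terminal state of $\mathcal M$; $f_{\mathcal M}(y)$ is the maximum expected utility. The water draining surrogate value $W^*_{\mathcal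 M}$ is the random variable with $\mathbb E[\max(y,W^*_{\mathcal M})]=f_{\mathcal M}(y)$ for all $y\in\mathbb R$. *)

theory Defs
  imports "HOL-Probability.Probability"
begin

record ('s, 'a) cimdp =
  states :: "'s set"
  start :: 's
  terminals :: "'s set"
  acts :: "'s \<Rightarrow> 'a set"
  cost :: "'a \<Rightarrow> real"
  trans :: "'s \<Rightarrow> 'a \<Rightarrow> 's pmf"
  val_dist :: "'s \<Rightarrow> real measure"

definition val :: "('s, 'a) cimdp \<Rightarrow> 's \<Rightarrow> real" where
  "val M s = (\<integral>x. x \<partial>val_dist M s)"

text \<open>The implicit action ``accept'' of terminal states is not part of \<^const>\<open>acts\<close> and
  induces no edge, so terminal states are sinks.\<close>

definition edges :: "('s, 'a) cimdp \<Rightarrow> ('s \<times> 's) set" where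
  "edges M = {(s, s'). s \<in> states M - terminals M \<and> (\<exists>a\<in>acts M s. s' \<in> set_pmf (trans M s a))}"

text \<open>In the third clause from the end, \<^term>\<open>val_dist M s\<close> is the conditional law, given state
  \<^term>\<open>s\<close>, of one underlying random variable that the actions reveal but do not affect;
  the law of total probability then makes it the mixture of the conditional laws at the
  successor states, whichever action is taken. The last clause says that every run of
  \<^term>\<open>H\<close> non-accepting actions from the start state ends in a terminal state; a run may
  also end in one earlier.\<close>

definition costly_info_mdp :: "nat \<Rightarrow> ('s, 'a) cimdp \<Rightarrow> bool" where
  "costly_info_mdp H M \<longleftrightarrow>
     finite (states M) \<and> start M \<in> states M \<and> terminals M \<subseteq> states M \<and>
     (\<forall>s\<in>states M - terminals M. finite (acts M s) \<and> acts M s \<noteq> {} \<and>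
        (\<forall>a\<in>acts M s. 0 \<le> cost M a \<and> set_pmf (trans M s a) \<subseteq> states M)) \<and>
     (\<forall>s\<in>states M. prob_space (val_dist M s) \<and> sets (val_dist M s) = sets borel \<and>
        (AE x in val_dist M s. 0 \<le> x) \<and> integrable (val_dist M s) (\<lambda>x. x)) \<and>
     (\<forall>s\<in>states M - terminals M. \<forall>a\<in>acts M s. \<forall>B\<in>sets borel.
        measure (val_dist M s) B =
          measure_pmf.expectation (trans M s a) (\<lambda>s'. measure (val_dist M s') B)) \<and>
     acyclic (edges M) \<and>
     (\<forall>s. (start M, s) \<in> edges M ^^ H \<longrightarrow> s \<in> terminals M)"

text \<open>An adaptive policy is a well-founded decision tree: the continuation after an advance
  depends on the state reached, hence on the whole history. \<open>Randomize\<close> nodes let the policy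
  randomize its choices.\<close>

datatype ('s, 'a) local_policy =
    Take_Outside
  | Take_Terminal
  | Local_Advance 'a "'s \<Rightarrow> ('s, 'a) local_policy"
  | Local_Randomize "('s, 'a) local_policy pmf"

primrec local_admissible :: "('s, 'a) cimdp \<Rightarrow> ('s, 'a) local_policy \<Rightarrow> 's \<Rightarrow> bool" where
  "local_admissible M Take_Outside = (\<lambda>s. True)"
| "local_admissible M Take_Terminal = (\<lambda>s. s \<in> terminals M)"
| "local_admissible M (Local_Advance a \<pi>) = (\<lambda>s.
     s \<in> states M - terminals M \<and> a \<in> acts M s \<and>
     (\<forall>s'\<in>set_pmf (trans M s a). local_admissible M (\<pi> s') s'))"
| "local_admissible M (Local_Randomize p) = (\<lambda>s.
     \<forall>adm\<in>set_pmf (map_pmf (local_admissible M) p). adm s)"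

primrec local_utility :: "('s, 'a) cimdp \<Rightarrow> real \<Rightarrow> ('s, 'a) local_policy \<Rightarrow> 's \<Rightarrow> real" where
  "local_utility M y Take_Outside = (\<lambda>s. y)"
| "local_utility M y Take_Terminal = (\<lambda>s. val M s)"
| "local_utility M y (Local_Advance a \<pi>) = (\<lambda>s.
     measure_pmf.expectation (trans M s a) (\<lambda>s'. local_utility M y (\<pi> s') s') - cost M a)"
| "local_utility M y (Local_Randomize p) = (\<lambda>s.
     measure_pmf.expectation (map_pmf (local_utility M y) p) (\<lambda>u. u s))"

text \<open>The utilities of admissible policies form a nonempty bounded set with a maximum, so the
  supremum here and in the global game below is this maximum.\<close>

definition local_opt :: "('s, 'a) cimdp \<Rightarrow> real \<Rightarrow> real" where
  "local_opt M y =
     (SUP \<pi>\<in>{\<pi>. local_admissible M \<pi> (start M)}. local_utility M y \<pi> (start M))"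

text \<open>\<^const>\<open>has_bochner_integral\<close> also asserts integrability, so the condition does not
  hinge on the default value of the integral.\<close>

definition water_draining_surrogate ::
    "'w measure \<Rightarrow> ('s, 'a) cimdp \<Rightarrow> ('w \<Rightarrow> real) \<Rightarrow> bool" where
  "water_draining_surrogate P M W \<longleftrightarrow>
     W \<in> borel_measurable P \<and>
     (\<forall>y. has_bochner_integral P (\<lambda>\<omega>. max y (W \<omega>)) (local_opt M y))"

definition matroid :: "'e set \<Rightarrow> 'e set set \<Rightarrow> bool" where
  "matroid E \<F> \<longleftrightarrow>
     finite E \<and> \<F> \<subseteq> Pow E \<and> {} \<in> \<F> \<and>
     (\<forall>X\<in>\<F>. \<forall>Y. Y \<subseteq> X \<longrightarrow> Y \<in> \<F>) \<and>
     (\<forall>X\<in>\<F>. \<forall>Y\<in>\<F>. card X < card Y \<longrightarrow> (\<exists>e\<in>Y - X. insert e X \<in> \<F>))"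

datatype ('s, 'a) policy =
    Stop
  | Advance nat 'a "'s \<Rightarrow> ('s, 'a) policy"
  | Accept nat "('s, 'a) policy"
  | Randomize "('s, 'a) policy pmf"

text \<open>Below, \<^term>\<open>x i\<close> is the current state of the \<^term>\<open>i\<close>-th MDP and \<^term>\<open>X\<close> is the set
  of accepted MDPs.\<close>

primrec admissible ::
    "nat \<Rightarrow> (nat \<Rightarrow> ('s, 'a) cimdp) \<Rightarrow> nat set set \<Rightarrow> ('s, 'a) policy \<Rightarrow> (nat \<Rightarrow> 's) \<Rightarrow> nat set \<Rightarrow> bool"
where
  "admissible n M \<F> Stop = (\<lambda>x X. True)"
| "admissible n M \<F> (Advance i a \<pi>) = (\<lambda>x X.
     i \<in> {1..n} - X \<and> x i \<in> states (M i) - terminals (M i) \<and> a \<in> acts (M i) (x i) \<and>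
     (\<forall>s'\<in>set_pmf (trans (M i) (x i) a). admissible n M \<F> (\<pi> s') (x(i := s')) X))"
| "admissible n M \<F> (Accept i \<pi>) = (\<lambda>x X.
     i \<in> {1..n} - X \<and> x i \<in> terminals (M i) \<and> X \<union> {i} \<in> \<F> \<and>
     admissible n M \<F> \<pi> x (X \<union> {i}))"
| "admissible n M \<F> (Randomize p) = (\<lambda>x X.
     \<forall>adm\<in>set_pmf (map_pmf (admissible n M \<F>) p). adm x X)"

primrec utility ::
    "(nat \<Rightarrow> ('s, 'a) cimdp) \<Rightarrow> ('s, 'a) policy \<Rightarrow> (nat \<Rightarrow> 's) \<Rightarrow> real"
where
  "utility M Stop = (\<lambda>x. 0)"
| "utility M (Advance i a \<pi>) = (\<lambda>x.
     measure_pmf.expectation (trans (M i) (x i) a) (\<lambda>s'. utility M (\<pi> s') (x(i := s')))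
       - cost (M i) a)"
| "utility M (Accept i \<pi>) = (\<lambda>x. val (M i) (x i) + utility M \<pi> x)"
| "utility M (Randomize p) = (\<lambda>x.
     measure_pmf.expectation (map_pmf (utility M) p) (\<lambda>u. u x))"

definition OPT :: "nat \<Rightarrow> (nat \<Rightarrow> ('s, 'a) cimdp) \<Rightarrow> nat set set \<Rightarrow> real" where
  "OPT n M \<F> =
     (SUP \<pi>\<in>{\<pi>. admissible n M \<F> \<pi> (\<lambda>i. start (M i)) {}}. utility M \<pi> (\<lambda>i. start (M i)))"

end

theory Submission
  imports Defs
begin

text \<open>Suppose that every state \<open>s\<close> of every MDP had a surrogate value \<open>W\<^sub>s\<close>, a random variable with
  \<open>E (max y W\<^sub>s) = f\<^sub>s y\<close>, where \<open>f\<^sub>s\<close> is the optimum of the local game started at \<open>s\<close>. As a potential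
  of states \<open>x\<close> and accepted set \<open>X\<close> take the expectation of \<open>Max (\<Sum>i\<in>S. W\<^sub>x\<^sub>i)\<close> over the sets \<open>S\<close> in
  the contraction of \<open>\<F>\<close> by \<open>X\<close>. In each single coordinate the maximum is constant or of the form
  \<open>B + max (A - B) v\<close>, so the inequality between \<open>f\<^sub>s\<close> and its successors carries over from the local
  game to the potential: no action increases utility plus expected potential.

  To avoid constructing \<open>W\<^sub>s\<close> exactly, the identity is only required for \<open>y\<close> on a grid of
  width \<open>\<epsilon>\<close> in \<open>[0, \<infinity>)\<close>; then \<open>W\<^sub>s\<close> can be chosen with values in a finite part of the grid, and
  interpolation preserves the one-step inequalities. At the start states the resulting variable
  exceeds the positive part of the given surrogate value by at most \<open>\<epsilon>\<close>, and replacing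
  surrogate values by their positive parts does not change the maximum over a downward closed
  family.\<close>

section \<open>Maxima over a set family as functions of a single weight\<close>

text \<open>The offset \<open>c\<close> absorbs the weights of coordinates that are already fixed.
  Peeling one coordinate off \<open>I\<close> thus leads to an expression of the same form, as an
  induction over \<open>I\<close> requires.\<close>

definition max_sum :: "'e set set \<Rightarrow> ('e set \<Rightarrow> real) \<Rightarrow> 'e set \<Rightarrow> ('e \<Rightarrow> real) \<Rightarrow> real" where
  "max_sum \<F> c I w = Max ((\<lambda>S. c S + (\<Sum>j\<in>S \<inter> I. w j)) ` \<F>)"

lemma max_sum_insert:
  assumes "finite I" "i \<notin> I"
  shows "max_sum \<F> c (insert i I) (w(i := v)) =
    max_sum \<F> (\<lambda>S. c S + (if i \<in> S then v else 0)) I w"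
proof -
  have "c S + (\<Sum>j\<in>S \<inter> insert i I. (w(i := v)) j) =
      c S + (if i \<in> S then v else 0) + (\<Sum>j\<in>S \<inter> I. w j)" for S
  proof -
    have "(\<Sum>j\<in>S \<inter> I. (w(i := v)) j) = (\<Sum>j\<in>S \<inter> I. w j)"
      using assms(2) by (intro sum.cong) auto
    with assms show ?thesis
      by (cases "i \<in> S") (simp_all add: Int_insert_right)
  qed
  then show ?thesis unfolding max_sum_def by (simp only:)
qed

text \<open>Sets that avoid \<open>i\<close> contribute a constant \<open>A\<close>, and there is
  one since \<open>{} \<in> \<F>\<close>; sets that contain \<open>i\<close> contribute
  \<open>B + v\<close>. The constant case occurs when no set contains \<open>i\<close>.\<close>

lemma max_sum_cases:
  fixes \<F> :: "'e set set"
  assumes "finite \<F>" "{} \<in> \<F>"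
  obtains (const) A where "\<And>v. max_sum \<F> (\<lambda>S. c S + (if i \<in> S then v else 0)) I w = A"
    | (max) A B where
      "\<And>v. max_sum \<F> (\<lambda>S. c S + (if i \<in> S then v else 0)) I w = B + max (A - B) v"
proof -
  define g where "g S = c S + (\<Sum>j\<in>S \<inter> I. w j)" for S
  define F0 where "F0 = {S \<in> \<F>. i \<notin> S}"
  define F1 where "F1 = {S \<in> \<F>. i \<in> S}"
  have F: "\<F> = F0 \<union> F1" "finite F0" "finite F1" "F0 \<noteq> {}"
    using assms by (auto simp: F0_def F1_def)
  have "max_sum \<F> (\<lambda>S. c S + (if i \<in> S then v else 0)) I w =
      Max (g ` F0 \<union> (\<lambda>S. g S + v) ` F1)" for v
  proof -
    have "(\<lambda>S. c S + (if i \<in> S then v else 0) + (\<Sum>j\<in>S \<inter> I. w j)) ` \<F> =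
        g ` F0 \<union> (\<lambda>S. g S + v) ` F1"
      unfolding F(1) image_Un
      by (intro arg_cong2[where f = "(\<union>)"] image_cong)
        (auto simp: g_def F0_def F1_def)
    then show ?thesis by (simp add: max_sum_def)
  qed
  note eq = this
  show thesis
  proof (cases "F1 = {}")
    case True
    then show ?thesis using const eq by simp
  next
    case False
    have "Max (g ` F0 \<union> (\<lambda>S. g S + v) ` F1) =
        Max (g ` F1) + max (Max (g ` F0) - Max (g ` F1)) v" for v
    proof -
      have "Max ((\<lambda>S. g S + v) ` F1) = Max (g ` F1) + v"
        using F False by (intro Max_add_commute) auto
      then show ?thesis using F False by (subst Max_Un) (simp_all add: max_def del: Max_le_iff)
    qed
    then show ?thesis using max eq by simp
  qed
qed

section \<open>Integrability and product distributions\<close>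

lemma integrable_Max:
  fixes g :: "'i \<Rightarrow> 'a \<Rightarrow> real"
  assumes "finite J" "J \<noteq> {}" "\<And>S. S \<in> J \<Longrightarrow> integrable M (g S)"
  shows "integrable M (\<lambda>x. Max ((\<lambda>S. g S x) ` J))"
  using assms
proof (induction J rule: finite_ne_induct)
  case (insert S J)
  then have "integrable M (\<lambda>x. max (g S x) (Max ((\<lambda>S. g S x) ` J)))" by simp
  then show ?case using insert by simp
qed simp

lemma integrable_max_sum:
  assumes "finite \<F>" "\<F> \<noteq> {}" "\<And>S. S \<in> \<F> \<Longrightarrow> integrable M (\<lambda>x. c x S)"
    and "finite I" "\<And>i. i \<in> I \<Longrightarrow> integrable M (\<lambda>x. w x i)"
  shows "integrable M (\<lambda>x. max_sum \<F> (c x) I (w x))"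
  unfolding max_sum_def using assms
  by (intro integrable_Max Bochner_Integration.integrable_add Bochner_Integration.integrable_sum)
    auto

lemma finite_set_Pi_pmf:
  assumes "finite I" "\<And>i. i \<in> I \<Longrightarrow> finite (set_pmf (D i))"
  shows "finite (set_pmf (Pi_pmf I d D))"
  using assms by (simp add: set_Pi_pmf finite_PiE_dflt)

text \<open>The new coordinate is integrated innermost, so that an inequality in this one coordinate
  can be applied with all others frozen. Finite supports turn every expectation into a finite
  sum.\<close>

lemma expectation_Pi_pmf_insert:
  fixes h :: "('i \<Rightarrow> real) \<Rightarrow> real"
  assumes "finite I" "i \<notin> I" "\<And>j. j \<in> insert i I \<Longrightarrow> finite (set_pmf (D j))"
  shows "measure_pmf.expectation (Pi_pmf (insert i I) d D) h =
    measure_pmf.expectation (Pi_pmf I d D)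
      (\<lambda>w. measure_pmf.expectation (D i) (\<lambda>v. h (w(i := v))))"
proof -
  have fin: "finite (set_pmf (Pi_pmf I d D))" "finite (set_pmf (D i))"
    using assms by (auto intro: finite_set_Pi_pmf)
  have "Pi_pmf (insert i I) d D =
      Pi_pmf I d D \<bind> (\<lambda>w. map_pmf (\<lambda>v. w(i := v)) (D i))"
    unfolding Pi_pmf_insert'[OF assms(1,2)] map_pmf_def
    by (subst bind_commute_pmf) (simp add: bind_assoc_pmf)
  then show ?thesis
    using fin
    by (simp add: pmf_expectation_bind[where A = "set_pmf (Pi_pmf I d D)"]
        integral_measure_pmf[where A = "set_pmf (Pi_pmf I d D)"])
qed

lemma integrable_PiM_component:
  fixes \<mu> :: "'i \<Rightarrow> real measure"
  assumes "\<And>i. i \<in> I \<Longrightarrow> prob_space (\<mu> i)" "\<And>i. i \<in> I \<Longrightarrow> integrable (\<mu> i) (\<lambda>v. v)" "i \<in> I"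
  shows "integrable (PiM I \<mu>) (\<lambda>w. w i)"
proof -
  have "integrable (distr (PiM I \<mu>) (\<mu> i) (\<lambda>w. w i)) (\<lambda>v. v)"
    using assms by (simp add: distr_PiM_component)
  then show ?thesis by (rule integrable_distr[rotated]) (use assms in measurable)
qed

text \<open>The coordinates are exchanged one at a time, each at cost \<open>\<epsilon>\<close>: in a single coordinate
  \<^const>\<open>max_sum\<close> is either constant or of the form \<open>B + max y v\<close>.\<close>

lemma expectation_max_sum_le:
  fixes \<mu> :: "'i \<Rightarrow> real measure" and D :: "'i \<Rightarrow> real pmf" and \<epsilon> :: real
  assumes "finite I" "finite \<F>" "{} \<in> \<F>" "\<epsilon> \<ge> 0"
    and "\<And>i. i \<in> I \<Longrightarrow> finite (set_pmf (D i))"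
    and "\<And>i. i \<in> I \<Longrightarrow> prob_space (\<mu> i)"
    and "\<And>i. i \<in> I \<Longrightarrow> integrable (\<mu> i) (\<lambda>v. v)"
    and "\<And>i y. i \<in> I \<Longrightarrow>
      measure_pmf.expectation (D i) (\<lambda>v. max y v) \<le> (\<integral>v. max y v \<partial>\<mu> i) + \<epsilon>"
  shows "measure_pmf.expectation (Pi_pmf I d D) (max_sum \<F> c I) \<le>
    (\<integral>w. max_sum \<F> c I w \<partial>PiM I \<mu>) + card I * \<epsilon>"
  using assms(1,5-8)
proof (induction I arbitrary: c rule: finite_induct)
  case empty
  interpret prob_space "PiM {} \<mu>" by (intro prob_space_PiM) auto
  show ?case by (simp add: max_sum_def prob_space)
next
  case (insert i I)
  have "\<F> \<noteq> {}" using assms by auto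
  define C where "C v = (\<lambda>S. c S + (if i \<in> S then v else 0))" for v :: real
  have h: "max_sum \<F> c (insert i I) (w(i := v)) = max_sum \<F> (C v) I w" for v w
    using insert by (simp add: max_sum_insert C_def)
  interpret i: prob_space "\<mu> i" using insert by simp
  interpret I: prob_space "PiM I \<mu>" using insert by (intro prob_space_PiM) auto
  interpret pair_prob_space "\<mu> i" "PiM I \<mu>" ..
  have int_id: "integrable (\<mu> i) (\<lambda>v. v)" using insert by simp
  have "integrable (\<mu> i) (\<lambda>v. C v S)" for S
    using int_id by (cases "i \<in> S") (simp_all add: C_def)
  then have int_C: "integrable (\<mu> i) (\<lambda>v. max_sum \<F> (C v) I w)" for w
    using insert.hyps \<open>\<F> \<noteq> {}\<close> assms(2) by (intro integrable_max_sum) auto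
  have fin_I: "finite (set_pmf (Pi_pmf I d D))"
    using insert by (intro finite_set_Pi_pmf) auto
  have one: "measure_pmf.expectation (D i) (\<lambda>v. max_sum \<F> (C v) I w) \<le>
      (\<integral>v. max_sum \<F> (C v) I w \<partial>\<mu> i) + \<epsilon>" for w
  proof -
    consider (const) A where "\<And>v. max_sum \<F> (C v) I w = A"
      | (max) A B where "\<And>v. max_sum \<F> (C v) I w = B + max (A - B) v"
      unfolding C_def by (rule max_sum_cases[OF assms(2,3), of c i I w]) blast+
    then show ?thesis
    proof cases
      case const
      then show ?thesis using assms by (simp add: i.prob_space)
    next
      case (max A B)
      have "finite (set_pmf (D i))" using insert by simp
      moreover have "measure_pmf.expectation (D i) (\<lambda>v. max (A - B) v) \<le>
          (\<integral>v. max (A - B) v \<partial>\<mu> i) + \<epsilon>"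
        using insert by simp
      ultimately show ?thesis unfolding max
        using int_id by (simp add: integrable_measure_pmf_finite i.prob_space)
    qed
  qed
  \<comment> \<open>Writing the product as an image of a pair product separates coordinate
    \<open>i\<close>, so that Fubini applies.\<close>
  have PiM: "PiM (insert i I) \<mu> =
      distr (\<mu> i \<Otimes>\<^sub>M PiM I \<mu>) (PiM (insert i I) \<mu>) (\<lambda>(v, w). w(i := v))"
    using insert by (intro distr_pair_PiM_eq_PiM[symmetric]) auto
  interpret ins: prob_space "PiM (insert i I) \<mu>" using insert by (intro prob_space_PiM) auto
  have int_ins: "integrable (PiM (insert i I) \<mu>) (max_sum \<F> c (insert i I))"
    using insert.hyps insert.prems(2,3) \<open>\<F> \<noteq> {}\<close> assms(2)
    by (intro integrable_max_sum integrable_PiM_component) auto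
  have upd: "(\<lambda>(v, w). w(i := v)) \<in> \<mu> i \<Otimes>\<^sub>M PiM I \<mu> \<rightarrow>\<^sub>M PiM (insert i I) \<mu>"
    by measurable
  have int_pair: "integrable (\<mu> i \<Otimes>\<^sub>M PiM I \<mu>) (\<lambda>(v, w). max_sum \<F> (C v) I w)"
    using integrable_distr[OF upd, folded PiM, OF int_ins]
    by (simp add: case_prod_beta' h)
  have eq: "(\<integral>w. max_sum \<F> c (insert i I) w \<partial>PiM (insert i I) \<mu>) =
      (\<integral>v. (\<integral>w. max_sum \<F> (C v) I w \<partial>PiM I \<mu>) \<partial>\<mu> i)"
  proof -
    have "(\<integral>w. max_sum \<F> c (insert i I) w \<partial>PiM (insert i I) \<mu>) =
        (\<integral>x. max_sum \<F> c (insert i I) (case x of (v, w) \<Rightarrow> w(i := v)) \<partial>(\<mu> i \<Otimes>\<^sub>M PiM I \<mu>))"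
      by (rule integral_distr[OF upd borel_measurable_integrable[OF int_ins], folded PiM])
    also have "\<dots> = (\<integral>x. (case x of (v, w) \<Rightarrow> max_sum \<F> (C v) I w) \<partial>(\<mu> i \<Otimes>\<^sub>M PiM I \<mu>))"
      by (simp add: case_prod_beta' h)
    finally show ?thesis using integral_fst'[OF int_pair] by simp
  qed
  have "measure_pmf.expectation (Pi_pmf (insert i I) d D) (max_sum \<F> c (insert i I)) =
      measure_pmf.expectation (Pi_pmf I d D)
        (\<lambda>w. measure_pmf.expectation (D i) (\<lambda>v. max_sum \<F> (C v) I w))"
    using insert by (subst expectation_Pi_pmf_insert) (auto simp: h)
  also have "\<dots> \<le> measure_pmf.expectation (Pi_pmf I d D)
      (\<lambda>w. (\<integral>v. max_sum \<F> (C v) I w \<partial>\<mu> i) + \<epsilon>)"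
    using fin_I by (intro integral_mono integrable_measure_pmf_finite one)
  also have "\<dots> = measure_pmf.expectation (Pi_pmf I d D)
      (\<lambda>w. \<integral>v. max_sum \<F> (C v) I w \<partial>\<mu> i) + \<epsilon>"
    using fin_I by (simp add: integrable_measure_pmf_finite)
  \<comment> \<open>A finite expectation commutes with the integral over \<open>\<mu> i\<close>.
    With \<open>v\<close> now fixed inside, the induction hypothesis applies with the offset
    \<open>C v\<close>.\<close>
  also have "measure_pmf.expectation (Pi_pmf I d D)
      (\<lambda>w. \<integral>v. max_sum \<F> (C v) I w \<partial>\<mu> i) =
      (\<integral>v. measure_pmf.expectation (Pi_pmf I d D) (max_sum \<F> (C v) I) \<partial>\<mu> i)"
    using fin_I int_C
    by (simp add: integral_measure_pmf[where A = "set_pmf (Pi_pmf I d D)"])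
  also have "\<dots> \<le> (\<integral>v. (\<integral>w. max_sum \<F> (C v) I w \<partial>PiM I \<mu>) + card I * \<epsilon> \<partial>\<mu> i)"
  proof (intro integral_mono)
    show "integrable (\<mu> i) (\<lambda>v. measure_pmf.expectation (Pi_pmf I d D) (max_sum \<F> (C v) I))"
      using fin_I int_C
      by (simp add: integral_measure_pmf[where A = "set_pmf (Pi_pmf I d D)"])
    show "integrable (\<mu> i) (\<lambda>v. (\<integral>w. max_sum \<F> (C v) I w \<partial>PiM I \<mu>) + card I * \<epsilon>)"
      using integrable_fst'[OF int_pair] by simp
    show "measure_pmf.expectation (Pi_pmf I d D) (max_sum \<F> (C v) I) \<le>
        (\<integral>w. max_sum \<F> (C v) I w \<partial>PiM I \<mu>) + card I * \<epsilon>" for v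
      using insert by (intro insert.IH) auto
  qed
  also have "\<dots> = (\<integral>v. (\<integral>w. max_sum \<F> (C v) I w \<partial>PiM I \<mu>) \<partial>\<mu> i) + card I * \<epsilon>"
    using integrable_fst'[OF int_pair] by (simp add: i.prob_space)
  finally show ?case
    using insert by (simp add: eq algebra_simps)
qed

subsection \<open>Discretized surrogate values\<close>

text \<open>The weights \<open>p\<close> are the second differences of \<open>f\<close>.\<close>

lemma exists_grid_pmf:
  fixes f :: "nat \<Rightarrow> real" and \<epsilon> :: real
  assumes "\<epsilon> > 0" and mono: "f 0 \<le> f 1"
    and convex: "\<And>k. 2 * f (Suc k) \<le> f k + f (Suc (Suc k))"
    and "f m = m * \<epsilon>" "f (Suc m) = Suc m * \<epsilon>"
  obtains D :: "real pmf" where "set_pmf D \<subseteq> (\<lambda>j. real j * \<epsilon>) ` {..m}"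
    "\<And>k. k \<le> m \<Longrightarrow> measure_pmf.expectation D (\<lambda>v. max (k * \<epsilon>) v) = f k"
proof -
  \<comment> \<open>If \<open>D\<close> represents \<open>f\<close>, the slope of \<open>f\<close>
    between the grid points \<open>j\<close> and \<open>Suc j\<close> is the probability that
    \<open>D\<close> is at most \<open>j * \<epsilon>\<close>. So \<open>F\<close> is the
    distribution function and \<open>p\<close> consists of its jumps; the first slope
    \<open>F 0\<close> becomes the atom at 0.\<close>
  define F where "F j = (f (Suc j) - f j) / \<epsilon>" for j
  define p where "p j = (if j = 0 then F 0 else if j \<le> m then F j - F (j - 1) else 0)" for j
  have F_m: "F m = 1" using assms by (simp add: F_def field_simps)
  have "F j \<le> F (Suc j)" for j
    using assms(1) convex[of j] unfolding F_def by (intro divide_right_mono) auto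
  moreover have "F 0 \<ge> 0" using assms(1) mono by (simp add: F_def)
  ultimately have p_nonneg: "p j \<ge> 0" for j
    by (cases j) (auto simp: p_def)
  have sum_p: "(\<Sum>j\<le>k. p j) = F k" if "k \<le> m" for k
    using that by (induction k) (auto simp: p_def)
  have sum_p_m: "(\<Sum>j\<le>m. p j) = 1" using sum_p F_m by simp
  have p0: "p j = 0" if "j > m" for j using that by (simp add: p_def)
  have "(\<integral>\<^sup>+ j. ennreal (p j) \<partial>count_space UNIV) = (\<Sum>j\<le>m. ennreal (p j))"
    by (intro nn_integral_count_space') (auto simp: p0 not_le)
  also have "\<dots> = 1" using sum_p_m p_nonneg by (simp add: sum_ennreal)
  finally have pmf_p: "pmf (embed_pmf p) j = p j" for j
    using p_nonneg by (intro pmf_embed_pmf) auto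
  have set_p: "set_pmf (embed_pmf p) \<subseteq> {..m}"
    by (metis atMost_iff not_le p0 pmf_p set_pmf_iff subsetI)
  define D where "D = map_pmf (\<lambda>j. real j * \<epsilon>) (embed_pmf p)"
  show thesis
  proof
    show "set_pmf D \<subseteq> (\<lambda>j. real j * \<epsilon>) ` {..m}"
      using set_p by (auto simp: D_def)
    fix k assume "k \<le> m"
    \<comment> \<open>Summation by parts, started at \<open>l = k\<close>, where the maximum is
      \<open>k * \<epsilon>\<close> for all indices up to \<open>k\<close>. At \<open>l = m\<close>
      the first two terms cancel because \<open>F m = 1\<close> and
      \<open>f m = m * \<epsilon>\<close>.\<close>
    have part: "(\<Sum>j\<le>l. p j * max (k * \<epsilon>) (j * \<epsilon>)) = F l * (l * \<epsilon>) - f l + f k"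
      if "k \<le> l" "l \<le> m" for l
      using that
    proof (induction l rule: dec_induct)
      case base
      have "(\<Sum>j\<le>k. p j * max (k * \<epsilon>) (j * \<epsilon>)) = (\<Sum>j\<le>k. p j * (k * \<epsilon>))"
        using assms(1) by (intro sum.cong) (auto simp: max_def)
      also have "\<dots> = F k * (k * \<epsilon>)"
        using sum_p[OF base] by (simp add: sum_distrib_right[symmetric])
      finally show ?case by simp
    next
      case (step l)
      have max: "max (k * \<epsilon>) (Suc l * \<epsilon>) = Suc l * \<epsilon>"
        using step assms(1) by (auto simp: max_def)
      have p: "p (Suc l) = F (Suc l) - F l"
        using step by (simp add: p_def)
      have f: "f (Suc l) = f l + F l * \<epsilon>"
        using assms(1) by (simp add: F_def)
      have IH: "(\<Sum>j\<le>l. p j * max (k * \<epsilon>) (j * \<epsilon>)) = F l * (l * \<epsilon>) - f l + f k"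
        using step by simp
      show ?case
        unfolding sum.atMost_Suc IH max p f by (simp add: algebra_simps)
    qed
    have "measure_pmf.expectation D (\<lambda>v. max (k * \<epsilon>) v) =
        (\<Sum>j\<le>m. p j * max (k * \<epsilon>) (j * \<epsilon>))"
      using set_p unfolding D_def integral_map_pmf
      by (subst integral_measure_pmf[where A = "{..m}"]) (auto simp: pmf_p)
    also have "\<dots> = f k"
      using part[OF \<open>k \<le> m\<close>] F_m assms by simp
    finally show "measure_pmf.expectation D (\<lambda>v. max (k * \<epsilon>) v) = f k" .
  qed
qed

text \<open>Between neighbouring grid points \<open>max y v\<close> is affine in \<open>y\<close> for every grid value \<open>v\<close>.\<close>

lemma expectation_max_interpolation:
  fixes y \<epsilon> :: real
  assumes "\<epsilon> > 0"
  shows "\<exists>(k::nat) t::real. 0 \<le> t \<and> t \<le> 1 \<and>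
    (\<forall>D. finite (set_pmf D) \<longrightarrow> set_pmf D \<subseteq> range (\<lambda>j::nat. j * \<epsilon>) \<longrightarrow>
      measure_pmf.expectation D (\<lambda>v. max y v) =
        (1 - t) * measure_pmf.expectation D (\<lambda>v. max (k * \<epsilon>) v) +
        t * measure_pmf.expectation D (\<lambda>v. max (Suc k * \<epsilon>) v))"
proof -
  define k where "k = nat \<lfloor>y / \<epsilon>\<rfloor>"
  \<comment> \<open>For negative \<open>y\<close>, \<open>nat\<close> truncates the floor to
    \<open>k = 0\<close>, and \<open>t = 0\<close> replaces \<open>y\<close> by 0: grid values are
    nonnegative, so \<open>max y v = max 0 v\<close>.\<close>
  define t where "t = (if y < 0 then 0 else y / \<epsilon> - k)"
  have k: "y \<ge> 0 \<Longrightarrow> real k \<le> y / \<epsilon>" "y / \<epsilon> < real k + 1"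
    using assms unfolding k_def by (auto simp: floor_le_iff) linarith+
  have "0 \<le> t" "t \<le> 1" using k by (auto simp: t_def)
  have y: "y = (1 - t) * (k * \<epsilon>) + t * (Suc k * \<epsilon>)" if "y \<ge> 0"
    using that assms by (simp add: t_def algebra_simps)
  have max: "max y (j * \<epsilon>) = (1 - t) * max (k * \<epsilon>) (j * \<epsilon>) + t * max (Suc k * \<epsilon>) (j * \<epsilon>)"
    for j :: nat
  proof (cases "y < 0")
    case True
    then have "k = 0" using assms by (simp add: k_def divide_nonpos_pos)
    moreover have "y \<le> j * \<epsilon>" "0 \<le> j * \<epsilon>"
      using True assms by (auto intro: order_trans[of y 0])
    ultimately show ?thesis using True by (simp add: t_def max_def)
  next
    case False
    show ?thesis
    proof (cases "j \<le> k")
      case True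
      then have "real j * \<epsilon> \<le> k * \<epsilon>" "real j * \<epsilon> \<le> Suc k * \<epsilon>"
        using assms by simp_all
      moreover have "k * \<epsilon> \<le> y" using k False assms by (simp add: field_simps)
      ultimately have "max y (j * \<epsilon>) = y" "max (k * \<epsilon>) (j * \<epsilon>) = k * \<epsilon>"
        "max (Suc k * \<epsilon>) (j * \<epsilon>) = Suc k * \<epsilon>"
        by simp_all
      then show ?thesis using y False by (simp only: not_less)
    next
      case False
      then have "real (Suc k) \<le> j" by simp
      then have "Suc k * \<epsilon> \<le> real j * \<epsilon>" "k * \<epsilon> \<le> real j * \<epsilon>"
        using assms by (simp_all add: mult_right_mono del: of_nat_Suc)
      moreover have "y \<le> Suc k * \<epsilon>" using k assms by (simp add: field_simps)
      ultimately show ?thesis by (simp add: max_def algebra_simps)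
    qed
  qed
  show ?thesis
  proof (intro exI conjI allI impI)
    show "0 \<le> t" "t \<le> 1" by fact+
    fix D :: "real pmf"
    assume fin: "finite (set_pmf D)" and grid: "set_pmf D \<subseteq> range (\<lambda>j::nat. j * \<epsilon>)"
    have "measure_pmf.expectation D (\<lambda>v. max y v) = measure_pmf.expectation D
        (\<lambda>v. (1 - t) * max (k * \<epsilon>) v + t * max (Suc k * \<epsilon>) v)"
      using grid max by (intro integral_cong_AE) (auto simp: AE_measure_pmf_iff simp del: of_nat_Suc)
    also have "\<dots> = (1 - t) * measure_pmf.expectation D (\<lambda>v. max (k * \<epsilon>) v) +
        t * measure_pmf.expectation D (\<lambda>v. max (Suc k * \<epsilon>) v)"
      using fin by (simp add: integrable_measure_pmf_finite)
    finally show "measure_pmf.expectation D (\<lambda>v. max y v) =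
        (1 - t) * measure_pmf.expectation D (\<lambda>v. max (k * \<epsilon>) v) +
        t * measure_pmf.expectation D (\<lambda>v. max (Suc k * \<epsilon>) v)" .
  qed
qed

section \<open>Local games under deterministic policies\<close>

text \<open>The utility of a deterministic policy is affine in \<open>y\<close>. For \<^const>\<open>Local_Randomize\<close> this
  can fail, since the expectation of a non-integrable utility is \<open>0\<close>.\<close>

primrec deterministic :: "('s, 'a) local_policy \<Rightarrow> bool" where
  "deterministic Take_Outside \<longleftrightarrow> True"
| "deterministic Take_Terminal \<longleftrightarrow> True"
| "deterministic (Local_Advance a \<pi>) \<longleftrightarrow> (\<forall>s. deterministic (\<pi> s))"
| "deterministic (Local_Randomize p) \<longleftrightarrow> False"

text \<open>The starting state is a parameter because the potential needs surrogate values at every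
  state. At \<open>start M\<close> only the inequality \<open>det_opt_le_local_opt\<close> links
  this to \<open>local_opt\<close>; it has the right direction, since the discretized values have to
  be bounded from above there.\<close>

definition det_opt :: "('s, 'a) cimdp \<Rightarrow> 's \<Rightarrow> real \<Rightarrow> real" where
  "det_opt M s y =
     (SUP \<pi>\<in>{\<pi>. deterministic \<pi> \<and> local_admissible M \<pi> s}. local_utility M y \<pi> s)"

lemma finite_set_trans:
  assumes "costly_info_mdp H M" "s \<in> states M - terminals M" "a \<in> acts M s"
  shows "finite (set_pmf (trans M s a))"
  using assms unfolding costly_info_mdp_def by (meson finite_subset)

lemma trans_in_states:
  assumes "costly_info_mdp H M" "s \<in> states M - terminals M" "a \<in> acts M s"
    "s' \<in> set_pmf (trans M s a)"
  shows "s' \<in> states M"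
  using assms unfolding costly_info_mdp_def by blast

lemma cost_nonneg:
  assumes "costly_info_mdp H M" "s \<in> states M - terminals M" "a \<in> acts M s"
  shows "0 \<le> cost M a"
  using assms unfolding costly_info_mdp_def by blast

text \<open>Admissible randomized policies may have a non-integrable utility, whose expectation is then
  \<open>0\<close>; the assumption \<open>0 \<le> K\<close> covers this case.\<close>

lemma pmf_expectation_le_const:
  assumes "\<And>x. x \<in> set_pmf p \<Longrightarrow> g x \<le> K" "0 \<le> (K :: real)"
  shows "measure_pmf.expectation p g \<le> K"
proof (cases "integrable (measure_pmf p) g")
  case True
  then show ?thesis
    using assms by (intro measure_pmf.integral_le_const) (auto simp: AE_measure_pmf_iff)
next
  case False
  then show ?thesis using assms by (simp add: not_integrable_integral_eq)
qed

lemma pmf_expectation_mono: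
  fixes g :: "_ \<Rightarrow> real"
  assumes "finite (set_pmf p)" "\<And>x. x \<in> set_pmf p \<Longrightarrow> g x \<le> h x"
  shows "measure_pmf.expectation p g \<le> measure_pmf.expectation p h"
  using assms by (intro integral_mono_AE integrable_measure_pmf_finite) (auto simp: AE_measure_pmf_iff)

text \<open>Every leaf collects \<open>y\<close> or at most \<open>b\<close>, and advancing only
  averages and subtracts a nonnegative cost. Randomized policies are included, so the supremum in
  \<open>local_opt\<close> is taken over a bounded set.\<close>

lemma local_utility_le:
  assumes M: "costly_info_mdp H M" and "\<And>s. s \<in> terminals M \<Longrightarrow> val M s \<le> b"
    and "0 \<le> b" "local_admissible M \<pi> s"
  shows "local_utility M y \<pi> s \<le> max y b"
  using assms(4)
proof (induction \<pi> arbitrary: s)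
  case (Local_Advance a \<pi>)
  then have "measure_pmf.expectation (trans M s a) (\<lambda>s'. local_utility M y (\<pi> s') s') \<le> max y b"
    using \<open>0 \<le> b\<close> by (intro pmf_expectation_le_const) auto
  moreover have "0 \<le> cost M a" using Local_Advance.prems by (intro cost_nonneg[OF M]) auto
  ultimately show ?case by simp
next
  case (Local_Randomize p)
  then show ?case
    using \<open>0 \<le> b\<close> by (auto simp: max.coboundedI2 intro!: pmf_expectation_le_const)
qed (use assms(2) in \<open>auto simp: max.coboundedI2\<close>)

lemma exists_val_bound:
  assumes "costly_info_mdp H M"
  shows "\<exists>b\<ge>0. \<forall>s\<in>terminals M. val M s \<le> b"
proof -
  have "finite (terminals M)"
    using assms unfolding costly_info_mdp_def by (meson finite_subset)
  then have "val M s \<le> Max (insert 0 (val M ` terminals M))" if "s \<in> terminals M" for s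
    using that by simp
  moreover have "0 \<le> Max (insert 0 (val M ` terminals M))"
    using \<open>finite (terminals M)\<close> by simp
  ultimately show ?thesis by blast
qed

lemma bdd_above_local_utility:
  assumes "costly_info_mdp H M"
  shows "bdd_above ((\<lambda>\<pi>. local_utility M y \<pi> s) ` {\<pi>. local_admissible M \<pi> s})"
proof -
  obtain b where "0 \<le> b" "\<forall>s\<in>terminals M. val M s \<le> b"
    using exists_val_bound[OF assms] by blast
  then show ?thesis
    using local_utility_le[OF assms, of b] by (intro bdd_aboveI[of _ "max y b"]) auto
qed

lemma local_utility_le_det_opt:
  assumes "costly_info_mdp H M" "deterministic \<pi>" "local_admissible M \<pi> s"
  shows "local_utility M y \<pi> s \<le> det_opt M s y"
  unfolding det_opt_def
  using assms by (intro cSUP_upper bdd_above_mono[OF bdd_above_local_utility[OF assms(1)]]) auto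

lemma det_opt_least:
  assumes "\<And>\<pi>. deterministic \<pi> \<Longrightarrow> local_admissible M \<pi> s \<Longrightarrow> local_utility M y \<pi> s \<le> u"
  shows "det_opt M s y \<le> u"
  unfolding det_opt_def
proof (rule cSUP_least)
  have "Take_Outside \<in> {\<pi>. deterministic \<pi> \<and> local_admissible M \<pi> s}" by simp
  then show "{\<pi>. deterministic \<pi> \<and> local_admissible M \<pi> s} \<noteq> {}" by blast
qed (use assms in auto)

lemma det_opt_le_local_opt:
  assumes "costly_info_mdp H M"
  shows "det_opt M (start M) y \<le> local_opt M y"
  unfolding local_opt_def
  using assms by (intro det_opt_least cSUP_upper bdd_above_local_utility) auto

lemma val_le_det_opt:
  assumes "costly_info_mdp H M" "s \<in> terminals M"
  shows "val M s \<le> det_opt M s y"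
  using local_utility_le_det_opt[OF assms(1), of Take_Terminal s y] assms by simp

text \<open>If no terminal value exceeds \<open>y\<close>, no run earns more than the outside
  option. These are the boundary values that \<open>exists_grid_pmf\<close> asks for at
  \<open>m\<close> and \<open>Suc m\<close>.\<close>

lemma det_opt_eq_outside:
  assumes "costly_info_mdp H M" "\<And>s. s \<in> terminals M \<Longrightarrow> val M s \<le> b" "0 \<le> b" "b \<le> y"
  shows "det_opt M s y = y"
proof (rule antisym)
  show "det_opt M s y \<le> y"
    using local_utility_le[OF assms(1-3), of _ s y] assms(4) by (intro det_opt_least) auto
  show "y \<le> det_opt M s y"
    using local_utility_le_det_opt[OF assms(1), of Take_Outside s y] by simp
qed

lemma local_utility_mono:
  assumes M: "costly_info_mdp H M" and "deterministic \<pi>" "local_admissible M \<pi> s" "y \<le> z"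
  shows "local_utility M y \<pi> s \<le> local_utility M z \<pi> s"
  using assms(2,3)
proof (induction \<pi> arbitrary: s)
  case (Local_Advance a \<pi>)
  then show ?case
    using finite_set_trans[OF M, of s a] by (auto intro!: pmf_expectation_mono)
qed (use \<open>y \<le> z\<close> in auto)

lemma det_opt_mono:
  assumes "costly_info_mdp H M" "y \<le> z"
  shows "det_opt M s y \<le> det_opt M s z"
  using local_utility_mono[OF assms(1) _ _ assms(2)] local_utility_le_det_opt[OF assms(1)]
  by (meson det_opt_least order_trans)

lemma local_utility_midpoint:
  assumes M: "costly_info_mdp H M" and "deterministic \<pi>" "local_admissible M \<pi> s"
    and "2 * y = x + z"
  shows "2 * local_utility M y \<pi> s \<le> local_utility M x \<pi> s + local_utility M z \<pi> s"
  using assms(2,3)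
proof (induction \<pi> arbitrary: s)
  case (Local_Advance a \<pi>)
  have fin: "finite (set_pmf (trans M s a))"
    using Local_Advance.prems by (intro finite_set_trans[OF M]) auto
  have "measure_pmf.expectation (trans M s a) (\<lambda>s'. 2 * local_utility M y (\<pi> s') s') \<le>
      measure_pmf.expectation (trans M s a)
        (\<lambda>s'. local_utility M x (\<pi> s') s' + local_utility M z (\<pi> s') s')"
    using Local_Advance fin by (intro pmf_expectation_mono) auto
  then show ?case using fin by (simp add: integrable_measure_pmf_finite)
qed (use \<open>2 * y = x + z\<close> in auto)

text \<open>A supremum of functions affine in \<open>y\<close> is convex; on the grid this makes the
  second differences nonnegative.\<close>

lemma det_opt_midpoint:
  assumes "costly_info_mdp H M" "2 * y = x + z"
  shows "2 * det_opt M s y \<le> det_opt M s x + det_opt M s z"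
proof -
  have "det_opt M s y \<le> (det_opt M s x + det_opt M s z) / 2"
  proof (rule det_opt_least)
    fix \<pi> assume \<pi>: "deterministic \<pi>" "local_admissible M \<pi> s"
    show "local_utility M y \<pi> s \<le> (det_opt M s x + det_opt M s z) / 2"
      using local_utility_midpoint[OF assms(1) \<pi> assms(2)]
        local_utility_le_det_opt[OF assms(1) \<pi>, of x] local_utility_le_det_opt[OF assms(1) \<pi>, of z]
      by simp
  qed
  then show ?thesis by simp
qed

text \<open>Nearly optimal policies for the successors are glued behind the action \<open>a\<close>,
  which gives one policy for \<open>s\<close>; their common defect \<open>e\<close> is
  arbitrary.\<close>

lemma det_opt_advance:
  assumes M: "costly_info_mdp H M" and s: "s \<in> states M - terminals M" "a \<in> acts M s"
  shows "measure_pmf.expectation (trans M s a) (\<lambda>s'. det_opt M s' y) - cost M a \<le> det_opt M s y"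
proof (rule field_le_epsilon)
  fix e :: real assume "e > 0"
  \<comment> \<open>The policies are chosen for every \<open>s'\<close>, not only for successors,
    because \<open>deterministic\<close> constrains the whole continuation function.\<close>
  have "\<exists>\<pi>. deterministic \<pi> \<and> local_admissible M \<pi> s' \<and> det_opt M s' y - e \<le> local_utility M y \<pi> s'"
    for s'
  proof (rule ccontr)
    assume "\<not> ?thesis"
    then have "det_opt M s' y \<le> det_opt M s' y - e"
      by (intro det_opt_least) (meson linear)
    with \<open>e > 0\<close> show False by simp
  qed
  then obtain \<pi> where \<pi>: "\<And>s'. deterministic (\<pi> s')" "\<And>s'. local_admissible M (\<pi> s') s'"
      "\<And>s'. det_opt M s' y - e \<le> local_utility M y (\<pi> s') s'"
    by metis
  have fin: "finite (set_pmf (trans M s a))" using finite_set_trans[OF M s] .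
  have "measure_pmf.expectation (trans M s a) (\<lambda>s'. det_opt M s' y) - e =
      measure_pmf.expectation (trans M s a) (\<lambda>s'. det_opt M s' y - e)"
    using fin by (simp add: integrable_measure_pmf_finite)
  also have "\<dots> \<le> measure_pmf.expectation (trans M s a) (\<lambda>s'. local_utility M y (\<pi> s') s')"
    using fin \<pi> by (intro pmf_expectation_mono)
  also have "\<dots> - cost M a \<le> det_opt M s y"
    using local_utility_le_det_opt[OF M, of "Local_Advance a \<pi>" s y] \<pi> s by simp
  finally show "measure_pmf.expectation (trans M s a) (\<lambda>s'. det_opt M s' y) - cost M a \<le>
      det_opt M s y + e" by simp
qed

section \<open>Surrogate values on the grid\<close>

text \<open>The identity is required at grid points beyond \<open>m\<close> too, because
  interpolation may use any \<open>k\<close>.\<close>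

definition grid_surrogate :: "real \<Rightarrow> nat \<Rightarrow> ('s, 'a) cimdp \<Rightarrow> 's \<Rightarrow> real pmf \<Rightarrow> bool" where
  "grid_surrogate \<epsilon> m M s D \<longleftrightarrow> set_pmf D \<subseteq> (\<lambda>j. real j * \<epsilon>) ` {..m} \<and>
    (\<forall>k::nat. measure_pmf.expectation D (\<lambda>v. max (k * \<epsilon>) v) = det_opt M s (k * \<epsilon>))"

text \<open>Up to \<open>m\<close>, the second differences of \<open>det_opt\<close> provide the
  weights. From \<open>m\<close> on, both sides of the identity equal \<open>k * \<epsilon>\<close>:
  the support lies below, and no terminal value exceeds \<open>m * \<epsilon>\<close>.\<close>

lemma exists_grid_surrogate:
  assumes M: "costly_info_mdp H M" and "\<epsilon> > 0"
    and b: "\<And>s. s \<in> terminals M \<Longrightarrow> val M s \<le> b" "0 \<le> b" and m: "b \<le> m * \<epsilon>"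
  shows "\<exists>D. grid_surrogate \<epsilon> m M s D"
proof -
  have large: "det_opt M s (k * \<epsilon>) = k * \<epsilon>" if "m \<le> k" for k :: nat
  proof -
    have "m * \<epsilon> \<le> k * \<epsilon>" using that \<open>\<epsilon> > 0\<close> by simp
    then show ?thesis using det_opt_eq_outside[OF M b] m by simp
  qed
  obtain D :: "real pmf" where D: "set_pmf D \<subseteq> (\<lambda>j. real j * \<epsilon>) ` {..m}"
    "\<And>k. k \<le> m \<Longrightarrow> measure_pmf.expectation D (\<lambda>v. max (k * \<epsilon>) v) = det_opt M s (k * \<epsilon>)"
  proof (rule exists_grid_pmf[of \<epsilon> "\<lambda>k. det_opt M s (k * \<epsilon>)" m])
    show "det_opt M s (real 0 * \<epsilon>) \<le> det_opt M s (real 1 * \<epsilon>)"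
      using \<open>\<epsilon> > 0\<close> by (intro det_opt_mono[OF M]) simp
    show "2 * det_opt M s (Suc k * \<epsilon>) \<le> det_opt M s (k * \<epsilon>) + det_opt M s (Suc (Suc k) * \<epsilon>)" for k
      by (intro det_opt_midpoint[OF M]) (simp add: algebra_simps)
  qed (use large[of m] large[of "Suc m"] \<open>\<epsilon> > 0\<close> in auto)
  have "measure_pmf.expectation D (\<lambda>v. max (k * \<epsilon>) v) = det_opt M s (k * \<epsilon>)" if "m \<le> k" for k :: nat
  proof -
    have "v \<le> k * \<epsilon>" if v: "v \<in> set_pmf D" for v
    proof -
      obtain j :: nat where "v = j * \<epsilon>" "j \<le> m" using D(1) v by auto
      then show ?thesis using \<open>m \<le> k\<close> \<open>\<epsilon> > 0\<close> by simp
    qed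
    then have "measure_pmf.expectation D (\<lambda>v. max (k * \<epsilon>) v) = measure_pmf.expectation D (\<lambda>v. k * \<epsilon>)"
      by (intro integral_cong_AE) (auto simp: AE_measure_pmf_iff)
    then show ?thesis using large[OF that] by simp
  qed
  then show ?thesis using D by (metis grid_surrogate_def linear)
qed

lemma grid_surrogate_finite: "grid_surrogate \<epsilon> m M s D \<Longrightarrow> finite (set_pmf D)"
  unfolding grid_surrogate_def by (meson finite_atMost finite_imageI finite_subset)

lemma grid_surrogate_nonneg:
  assumes "grid_surrogate \<epsilon> m M s D" "\<epsilon> > 0" "v \<in> set_pmf D"
  shows "0 \<le> v"
  using assms unfolding grid_surrogate_def by auto

lemma grid_surrogate_zero:
  assumes "grid_surrogate \<epsilon> m M s D"
  shows "measure_pmf.expectation D (\<lambda>v. max 0 v) = det_opt M s 0"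
proof -
  have "measure_pmf.expectation D (\<lambda>v. max (real 0 * \<epsilon>) v) = det_opt M s (real 0 * \<epsilon>)"
    using assms unfolding grid_surrogate_def by blast
  then show ?thesis by simp
qed

text \<open>By nonnegativity the mean equals \<open>det_opt M s 0\<close>, and in the local game
  with outside option 0 the terminal value can be taken.\<close>

lemma grid_surrogate_terminal:
  assumes "costly_info_mdp H M" "s \<in> terminals M" "grid_surrogate \<epsilon> m M s D" "\<epsilon> > 0"
  shows "val M s \<le> measure_pmf.expectation D (\<lambda>v. v)"
proof -
  have "measure_pmf.expectation D (\<lambda>v. v) = measure_pmf.expectation D (\<lambda>v. max 0 v)"
    using grid_surrogate_nonneg[OF assms(3,4)]
    by (intro integral_cong_AE) (auto simp: AE_measure_pmf_iff)
  then show ?thesis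
    using val_le_det_opt[OF assms(1,2), of 0] grid_surrogate_zero[OF assms(3)] by simp
qed

text \<open>The interpolation parameters \<open>k\<close> and \<open>t\<close> depend on
  \<open>y\<close> but not on the distribution. Hence at all states the expectation is the same
  convex combination of \<open>det_opt\<close> at two grid points, and
  \<open>det_opt_advance\<close> at these points gives the inequality for every real
  \<open>y\<close>.\<close>

lemma grid_surrogate_advance:
  assumes M: "costly_info_mdp H M" and s: "s \<in> states M - terminals M" "a \<in> acts M s"
    and "\<epsilon> > 0" and D: "\<And>s. s \<in> states M \<Longrightarrow> grid_surrogate \<epsilon> m M s (D s)"
  shows "measure_pmf.expectation (trans M s a)
      (\<lambda>s'. measure_pmf.expectation (D s') (\<lambda>v. max y v)) - cost M a \<le>
    measure_pmf.expectation (D s) (\<lambda>v. max y v)"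
proof -
  obtain k :: nat and t :: real where t: "0 \<le> t" "t \<le> 1"
    and interp: "\<forall>D. finite (set_pmf D) \<longrightarrow> set_pmf D \<subseteq> range (\<lambda>j::nat. j * \<epsilon>) \<longrightarrow>
      measure_pmf.expectation D (\<lambda>v. max y v) =
        (1 - t) * measure_pmf.expectation D (\<lambda>v. max (k * \<epsilon>) v) +
        t * measure_pmf.expectation D (\<lambda>v. max (Suc k * \<epsilon>) v)"
    using expectation_max_interpolation[OF \<open>\<epsilon> > 0\<close>, of y] by (elim exE conjE)
  let ?E = "measure_pmf.expectation (trans M s a)"
  let ?f = "\<lambda>s. (1 - t) * det_opt M s (k * \<epsilon>) + t * det_opt M s (Suc k * \<epsilon>)"
  have f: "measure_pmf.expectation (D s) (\<lambda>v. max y v) = ?f s" if "s \<in> states M" for s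
  proof -
    have "set_pmf (D s) \<subseteq> range (\<lambda>j::nat. j * \<epsilon>)"
      using D[OF that] unfolding grid_surrogate_def by blast
    then have "measure_pmf.expectation (D s) (\<lambda>v. max y v) =
        (1 - t) * measure_pmf.expectation (D s) (\<lambda>v. max (k * \<epsilon>) v) +
        t * measure_pmf.expectation (D s) (\<lambda>v. max (Suc k * \<epsilon>) v)"
      using interp grid_surrogate_finite[OF D[OF that]] by blast
    then show ?thesis
      using D[OF that] unfolding grid_surrogate_def by (simp del: of_nat_Suc)
  qed
  have fin: "finite (set_pmf (trans M s a))" using finite_set_trans[OF M s] .
  have "?E (\<lambda>s'. measure_pmf.expectation (D s') (\<lambda>v. max y v)) = ?E ?f"
    using f trans_in_states[OF M s] by (intro integral_cong_AE) (auto simp: AE_measure_pmf_iff)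
  also have "\<dots> = (1 - t) * ?E (\<lambda>s'. det_opt M s' (k * \<epsilon>)) + t * ?E (\<lambda>s'. det_opt M s' (Suc k * \<epsilon>))"
    using fin by (simp add: integrable_measure_pmf_finite)
  also have "\<dots> - cost M a =
      (1 - t) * (?E (\<lambda>s'. det_opt M s' (k * \<epsilon>)) - cost M a) +
      t * (?E (\<lambda>s'. det_opt M s' (Suc k * \<epsilon>)) - cost M a)"
    by (simp add: algebra_simps)
  also have "\<dots> \<le> ?f s"
    using t by (intro add_mono mult_left_mono det_opt_advance[OF M s]) auto
  also have "?f s = measure_pmf.expectation (D s) (\<lambda>v. max y v)"
    using f s by simp
  finally show ?thesis .
qed

text \<open>Rounding \<open>max 0 y\<close> up to a grid point increases the maximum by at most
  \<open>\<epsilon>\<close>. At grid points the expectation under \<open>D\<close> is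
  \<open>det_opt\<close>, hence at most the \<open>local_opt\<close> that \<open>W\<close>
  represents. Clipping \<open>y\<close> at 0 produces the positive part of \<open>W\<close>.\<close>

lemma grid_surrogate_start_le:
  assumes M: "costly_info_mdp H M" and W: "water_draining_surrogate P M W" and "prob_space P"
    and "\<epsilon> > 0" and D: "grid_surrogate \<epsilon> m M (start M) D"
  shows "measure_pmf.expectation D (\<lambda>v. max y v) \<le> (\<integral>\<omega>. max y (max 0 (W \<omega>)) \<partial>P) + \<epsilon>"
proof -
  interpret prob_space P by fact
  have fin: "finite (set_pmf D)" using grid_surrogate_finite[OF D] .
  have int: "integrable P (\<lambda>\<omega>. max z (W \<omega>))" and eq: "(\<integral>\<omega>. max z (W \<omega>) \<partial>P) = local_opt M z" for z
    using W unfolding water_draining_surrogate_def has_bochner_integral_iff by auto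
  define k where "k = nat \<lceil>max 0 y / \<epsilon>\<rceil>"
  have "max 0 y / \<epsilon> \<ge> 0" using \<open>\<epsilon> > 0\<close> by simp
  then have "max 0 y / \<epsilon> \<le> k" "real k \<le> max 0 y / \<epsilon> + 1"
    unfolding k_def by linarith+
  then have k: "max 0 y \<le> k * \<epsilon>" "k * \<epsilon> \<le> max 0 y + \<epsilon>"
    using \<open>\<epsilon> > 0\<close> by (simp_all add: field_simps)
  have "measure_pmf.expectation D (\<lambda>v. max y v) \<le> measure_pmf.expectation D (\<lambda>v. max (k * \<epsilon>) v)"
    using fin k(1) by (intro pmf_expectation_mono) auto
  also have "\<dots> \<le> (\<integral>\<omega>. max (k * \<epsilon>) (W \<omega>) \<partial>P)"
    using D det_opt_le_local_opt[OF M] unfolding grid_surrogate_def eq by simp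
  also have "\<dots> \<le> (\<integral>\<omega>. max (max 0 y) (W \<omega>) + \<epsilon> \<partial>P)"
    using int k \<open>\<epsilon> > 0\<close> by (intro integral_mono) auto
  also have "\<dots> = (\<integral>\<omega>. max y (max 0 (W \<omega>)) \<partial>P) + \<epsilon>"
    using int[of "max 0 y"] by (simp add: prob_space ac_simps)
  finally show ?thesis .
qed

subsection \<open>The potential argument\<close>

lemma max_sum_nonneg:
  assumes "finite \<F>" "{} \<in> \<F>"
  shows "0 \<le> max_sum \<F> (\<lambda>_. 0) I w"
proof -
  have "0 + (\<Sum>j\<in>{} \<inter> I. w j) \<le> max_sum \<F> (\<lambda>_. 0) I w"
    unfolding max_sum_def using assms by (intro Max_ge finite_imageI imageI)
  then show ?thesis by simp
qed

text \<open>Removing the elements of nonpositive weight from a set leaves a member of the family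
  whose plain sum is the clipped sum of the original set. The other inequality holds
  termwise.\<close>

lemma Max_sum_positive_part:
  fixes w :: "'e \<Rightarrow> real"
  assumes "finite \<F>" "{} \<in> \<F>" "\<And>S. S \<in> \<F> \<Longrightarrow> finite S"
    and down: "\<And>S T. S \<in> \<F> \<Longrightarrow> T \<subseteq> S \<Longrightarrow> T \<in> \<F>"
  shows "Max ((\<lambda>S. \<Sum>i\<in>S. max 0 (w i)) ` \<F>) = Max ((\<lambda>S. \<Sum>i\<in>S. w i) ` \<F>)"
proof (rule antisym)
  show "Max ((\<lambda>S. \<Sum>i\<in>S. max 0 (w i)) ` \<F>) \<le> Max ((\<lambda>S. \<Sum>i\<in>S. w i) ` \<F>)"
  proof (intro Max.boundedI)
    fix u assume "u \<in> (\<lambda>S. \<Sum>i\<in>S. max 0 (w i)) ` \<F>"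
    then obtain S where S: "S \<in> \<F>" "u = (\<Sum>i\<in>S. max 0 (w i))" by blast
    have "u = (\<Sum>i\<in>{i\<in>S. 0 < w i}. w i)"
      unfolding S(2) using assms(3)[OF S(1)] by (intro sum.mono_neutral_cong_right) auto
    also have "\<dots> \<le> Max ((\<lambda>S. \<Sum>i\<in>S. w i) ` \<F>)"
      using assms(1) by (intro Max_ge finite_imageI imageI down[OF S(1)]) auto
    finally show "u \<le> \<dots>" .
  qed (use assms in auto)
  show "Max ((\<lambda>S. \<Sum>i\<in>S. w i) ` \<F>) \<le> Max ((\<lambda>S. \<Sum>i\<in>S. max 0 (w i)) ` \<F>)"
  proof (intro Max.boundedI)
    fix u assume "u \<in> (\<lambda>S. \<Sum>i\<in>S. w i) ` \<F>"
    then obtain S where S: "S \<in> \<F>" "u = (\<Sum>i\<in>S. w i)" by blast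
    have "u \<le> (\<Sum>i\<in>S. max 0 (w i))" unfolding S(2) by (intro sum_mono) simp
    also have "\<dots> \<le> Max ((\<lambda>S. \<Sum>i\<in>S. max 0 (w i)) ` \<F>)"
      using assms(1) S(1) by (intro Max_ge finite_imageI imageI)
    finally show "u \<le> \<dots>" .
  qed (use assms in auto)
qed

definition contraction :: "'e set set \<Rightarrow> 'e set \<Rightarrow> 'e set set" where
  "contraction \<F> X = {S. S \<inter> X = {} \<and> S \<union> X \<in> \<F>}"

lemma finite_contraction:
  assumes "finite \<F>"
  shows "finite (contraction \<F> X)"
proof (rule finite_subset)
  have "S = (S \<union> X) - X" if "S \<inter> X = {}" for S using that by blast
  then show "contraction \<F> X \<subseteq> (\<lambda>T. T - X) ` \<F>"
    unfolding contraction_def by blast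
qed (use assms in simp)

text \<open>A best completion of \<open>insert i X\<close>, extended by \<open>i\<close>, is a
  completion of \<open>X\<close>. So accepting \<open>i\<close> lowers the maximum by at least the
  weight \<open>w i\<close>.\<close>

lemma max_sum_contraction_insert:
  assumes "finite \<F>" "insert i X \<in> \<F>" "i \<notin> X" "finite I" "i \<in> I"
  shows "w i + max_sum (contraction \<F> (insert i X)) (\<lambda>_. 0) I w \<le>
    max_sum (contraction \<F> X) (\<lambda>_. 0) I w"
proof -
  have "{} \<in> contraction \<F> (insert i X)" using assms by (simp add: contraction_def)
  then have "max_sum (contraction \<F> (insert i X)) (\<lambda>_. 0) I w \<in>
      (\<lambda>S. 0 + (\<Sum>j\<in>S \<inter> I. w j)) ` contraction \<F> (insert i X)"
    unfolding max_sum_def using finite_contraction[OF assms(1)] by (intro Max_in) auto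
  then obtain S where S: "S \<in> contraction \<F> (insert i X)"
    "max_sum (contraction \<F> (insert i X)) (\<lambda>_. 0) I w = (\<Sum>j\<in>S \<inter> I. w j)" by auto
  have "insert i S \<in> contraction \<F> X" "i \<notin> S"
    using S(1) assms(3) by (auto simp: contraction_def)
  then have "0 + (\<Sum>j\<in>insert i S \<inter> I. w j) \<le> max_sum (contraction \<F> X) (\<lambda>_. 0) I w"
    unfolding max_sum_def using finite_contraction[OF assms(1)]
    by (intro Max_ge finite_imageI) blast+
  then show ?thesis using \<open>i \<notin> S\<close> S(2) assms by simp
qed

text \<open>With the other weights frozen, advancing MDP \<open>i\<close> is a move in a local game
  with outside option \<open>A - B\<close>, shifted by \<open>B\<close>. In the constant case
  advancing only incurs its cost.\<close>

lemma grid_surrogate_advance_max_sum: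
  assumes M: "costly_info_mdp H M" and s: "s \<in> states M - terminals M" "a \<in> acts M s"
    and "\<epsilon> > 0" and D: "\<And>s. s \<in> states M \<Longrightarrow> grid_surrogate \<epsilon> m M s (D s)"
    and "finite \<F>" "{} \<in> \<F>" "finite I" "i \<notin> I"
  shows "measure_pmf.expectation (trans M s a)
      (\<lambda>s'. measure_pmf.expectation (D s') (\<lambda>v. max_sum \<F> c (insert i I) (w(i := v)))) - cost M a \<le>
    measure_pmf.expectation (D s) (\<lambda>v. max_sum \<F> c (insert i I) (w(i := v)))"
proof -
  have c: "0 \<le> cost M a" using cost_nonneg[OF M s] .
  have fin: "finite (set_pmf (trans M s a))" using finite_set_trans[OF M s] .
  have fin_D: "finite (set_pmf (D s))" if "s \<in> states M" for s
    using grid_surrogate_finite[OF D[OF that]] .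
  show ?thesis
  proof (cases rule: max_sum_cases[OF assms(6,7), of c i I w])
    case (1 A)
    then show ?thesis using c by (simp add: max_sum_insert[OF assms(8,9)])
  next
    case (2 A B)
    have "measure_pmf.expectation (trans M s a)
        (\<lambda>s'. measure_pmf.expectation (D s') (\<lambda>v. B + max (A - B) v)) =
      measure_pmf.expectation (trans M s a)
        (\<lambda>s'. B + measure_pmf.expectation (D s') (\<lambda>v. max (A - B) v))"
      using fin_D trans_in_states[OF M s]
      by (intro integral_cong_AE) (auto simp: AE_measure_pmf_iff integrable_measure_pmf_finite)
    also have "\<dots> = B + measure_pmf.expectation (trans M s a)
        (\<lambda>s'. measure_pmf.expectation (D s') (\<lambda>v. max (A - B) v))"
      using fin by (simp add: integrable_measure_pmf_finite)
    also have "\<dots> - cost M a \<le> B + measure_pmf.expectation (D s) (\<lambda>v. max (A - B) v)"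
      using grid_surrogate_advance[where D = D, OF M s assms(4) D, of "A - B"] by simp
    also have "\<dots> = measure_pmf.expectation (D s) (\<lambda>v. B + max (A - B) v)"
      using fin_D s by (simp add: integrable_measure_pmf_finite)
    finally show ?thesis using 2 by (simp add: max_sum_insert[OF assms(8,9)])
  qed
qed

lemma pmf_expectation_swap:
  fixes g :: "'x \<Rightarrow> 'y \<Rightarrow> real"
  assumes "finite (set_pmf p)" "finite (set_pmf q)"
  shows "measure_pmf.expectation p (\<lambda>x. measure_pmf.expectation q (g x)) =
    measure_pmf.expectation q (\<lambda>y. measure_pmf.expectation p (\<lambda>x. g x y))"
  using assms
  by (simp add: integral_measure_pmf[where A = "set_pmf p"] integrable_measure_pmf_finite)

text \<open>Induction over the policy, with the potential at \<open>x\<close> and \<open>X\<close>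
  bounding the utility still to be collected. Advancing replaces one factor of the product
  distribution, and accepting changes the contraction. The invariant \<open>X \<in> \<F>\<close>
  puts \<open>{}\<close> into the contraction, which keeps the potential nonnegative.\<close>

lemma utility_le:
  assumes M: "\<And>i. i \<in> {1..n} \<Longrightarrow> costly_info_mdp H (M i)"
    and fin: "finite \<F>" and "\<epsilon> > 0"
    and D: "\<And>i s. i \<in> {1..n} \<Longrightarrow> s \<in> states (M i) \<Longrightarrow> grid_surrogate \<epsilon> m (M i) s (D i s)"
    and "admissible n M \<F> \<pi> x X" "X \<in> \<F>" "\<And>i. i \<in> {1..n} \<Longrightarrow> x i \<in> states (M i)"
  shows "utility M \<pi> x \<le> measure_pmf.expectation (Pi_pmf {1..n} 0 (\<lambda>i. D i (x i)))
    (max_sum (contraction \<F> X) (\<lambda>_. 0) {1..n})"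
  using assms(5-7)
proof (induction \<pi> arbitrary: x X)
  case Stop
  have "0 \<le> max_sum (contraction \<F> X) (\<lambda>_. 0) {1..n} w" for w
    using Stop fin by (intro max_sum_nonneg finite_contraction) (auto simp: contraction_def)
  then show ?case by (simp add: integral_nonneg_AE)
next
  case (Advance i a \<pi>)
  define I where "I = {1..n} - {i}"
  have i: "i \<in> {1..n}" and s: "x i \<in> states (M i) - terminals (M i)" "a \<in> acts (M i) (x i)"
    using Advance.prems by auto
  have I: "{1..n} = insert i I" "finite I" "i \<notin> I" using i by (auto simp: I_def)
  let ?V = "max_sum (contraction \<F> X) (\<lambda>_. 0) {1..n}"
  let ?T = "measure_pmf.expectation (trans (M i) (x i) a)"
  let ?Q = "Pi_pmf I 0 (\<lambda>j. D j (x j))"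
  have fin_D: "finite (set_pmf (D j s))" if "j \<in> {1..n}" "s \<in> states (M j)" for j s
    using grid_surrogate_finite[OF D[OF that]] .
  have fin_Q: "finite (set_pmf ?Q)"
    using I Advance.prems fin_D by (intro finite_set_Pi_pmf) auto
  have fin_T: "finite (set_pmf (trans (M i) (x i) a))"
    using finite_set_trans[OF M[OF i] s] .
  \<comment> \<open>Coordinate \<open>i\<close> is isolated: the distribution of the other
    coordinates does not depend on the new state \<open>s'\<close>.\<close>
  have \<Phi>: "measure_pmf.expectation (Pi_pmf {1..n} 0 (\<lambda>j. D j ((x(i := s')) j))) ?V =
      measure_pmf.expectation ?Q (\<lambda>w. measure_pmf.expectation (D i s') (\<lambda>v. ?V (w(i := v))))"
    if "s' \<in> states (M i)" for s'
  proof -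
    have "Pi_pmf I 0 (\<lambda>j. D j ((x(i := s')) j)) = ?Q"
      using I by (intro Pi_pmf_cong) auto
    then show ?thesis
      using I Advance.prems(3) fin_D that
      by (subst (1) I(1), subst expectation_Pi_pmf_insert) auto
  qed
  have "?T (\<lambda>s'. utility M (\<pi> s') (x(i := s'))) \<le>
      ?T (\<lambda>s'. measure_pmf.expectation (Pi_pmf {1..n} 0 (\<lambda>j. D j ((x(i := s')) j))) ?V)"
  proof (intro pmf_expectation_mono fin_T)
    fix s' assume s': "s' \<in> set_pmf (trans (M i) (x i) a)"
    then have adm: "admissible n M \<F> (\<pi> s') (x(i := s')) X"
      using Advance.prems(1) by simp
    show "utility M (\<pi> s') (x(i := s')) \<le>
        measure_pmf.expectation (Pi_pmf {1..n} 0 (\<lambda>j. D j ((x(i := s')) j))) ?V"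
      using Advance.prems trans_in_states[OF M[OF i] s s'] by (intro Advance.IH[OF _ adm]) auto
  qed
  also have "\<dots> = ?T (\<lambda>s'. measure_pmf.expectation ?Q
      (\<lambda>w. measure_pmf.expectation (D i s') (\<lambda>v. ?V (w(i := v)))))"
    using \<Phi> trans_in_states[OF M[OF i] s]
    by (intro integral_cong_AE) (auto simp: AE_measure_pmf_iff)
  \<comment> \<open>After the swap, the one-step inequality can be used for each fixed draw
    \<open>w\<close> of the other coordinates.\<close>
  also have "\<dots> = measure_pmf.expectation ?Q
      (\<lambda>w. ?T (\<lambda>s'. measure_pmf.expectation (D i s') (\<lambda>v. ?V (w(i := v)))))"
    using fin_T fin_Q by (rule pmf_expectation_swap)
  also have "\<dots> - cost (M i) a = measure_pmf.expectation ?Q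
      (\<lambda>w. ?T (\<lambda>s'. measure_pmf.expectation (D i s') (\<lambda>v. ?V (w(i := v)))) - cost (M i) a)"
    using fin_Q by (simp add: integrable_measure_pmf_finite)
  also have "\<dots> \<le> measure_pmf.expectation ?Q
      (\<lambda>w. measure_pmf.expectation (D i (x i)) (\<lambda>v. ?V (w(i := v))))"
    unfolding I(1) using Advance.prems(2)
    by (intro pmf_expectation_mono fin_Q
        grid_surrogate_advance_max_sum[OF M[OF i] s \<open>\<epsilon> > 0\<close> D[OF i] _ _ I(2,3)]
        finite_contraction fin) (auto simp: contraction_def)
  also have "\<dots> = measure_pmf.expectation (Pi_pmf {1..n} 0 (\<lambda>j. D j (x j))) ?V"
    using \<Phi>[of "x i"] s by simp
  finally show ?case by simp
next
  case (Accept i \<pi>)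
  have i: "i \<in> {1..n}" "i \<notin> X" "x i \<in> terminals (M i)" "insert i X \<in> \<F>"
    "admissible n M \<F> \<pi> x (insert i X)"
    using Accept.prems by auto
  let ?p = "Pi_pmf {1..n} 0 (\<lambda>i. D i (x i))"
  have fin_p: "finite (set_pmf ?p)"
    using Accept.prems(3) grid_surrogate_finite[OF D] by (intro finite_set_Pi_pmf) auto
  \<comment> \<open>The mean of \<open>D i (x i)\<close> becomes an expectation under the joint
    product, so that \<open>max_sum_contraction_insert\<close> can be applied to each draw
    \<open>w\<close>.\<close>
  have "measure_pmf.expectation ?p (\<lambda>w. w i) =
      measure_pmf.expectation (map_pmf (\<lambda>w. w i) ?p) (\<lambda>v. v)" by simp
  also have "\<dots> = measure_pmf.expectation (D i (x i)) (\<lambda>v. v)"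
    using i(1) by (subst Pi_pmf_component) auto
  finally have "val (M i) (x i) \<le> measure_pmf.expectation ?p (\<lambda>w. w i)"
    using grid_surrogate_terminal[OF M[OF i(1)] i(3) D \<open>\<epsilon> > 0\<close>] i(1) Accept.prems(3) by simp
  moreover have "utility M \<pi> x \<le>
      measure_pmf.expectation ?p (max_sum (contraction \<F> (insert i X)) (\<lambda>_. 0) {1..n})"
    using i Accept.prems(3) by (intro Accept.IH) auto
  ultimately have "utility M (Accept i \<pi>) x \<le> measure_pmf.expectation ?p (\<lambda>w. w i) +
      measure_pmf.expectation ?p (max_sum (contraction \<F> (insert i X)) (\<lambda>_. 0) {1..n})"
    by simp
  also have "\<dots> = measure_pmf.expectation ?p
      (\<lambda>w. w i + max_sum (contraction \<F> (insert i X)) (\<lambda>_. 0) {1..n} w)"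
    using fin_p by (simp add: integrable_measure_pmf_finite)
  also have "\<dots> \<le> measure_pmf.expectation ?p (max_sum (contraction \<F> X) (\<lambda>_. 0) {1..n})"
    using i fin by (intro pmf_expectation_mono fin_p max_sum_contraction_insert) auto
  finally show ?case .
next
  case (Randomize p)
  \<comment> \<open>A randomization with non-integrable utility has expectation 0 by default, which
    a nonnegative potential still bounds.\<close>
  have "0 \<le> max_sum (contraction \<F> X) (\<lambda>_. 0) {1..n} w" for w
    using Randomize.prems fin
    by (intro max_sum_nonneg finite_contraction) (auto simp: contraction_def)
  then show ?case
    using Randomize by (auto intro!: pmf_expectation_le_const integral_nonneg_AE)
qed

section \<open>Transfer to the given independent surrogate values\<close>

text \<open>The joint law of independent variables is the product of their laws. The empty index set
  is treated apart, since \<open>indep_vars_iff_distr_eq_PiM'\<close> speaks of nonempty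
  ones.\<close>

lemma integral_indep_vars:
  fixes f :: "('i \<Rightarrow> 'b) \<Rightarrow> real"
  assumes "prob_space P" "finite I" "prob_space.indep_vars P N X I"
    and "f \<in> borel_measurable (PiM I N)"
  shows "(\<integral>w. f w \<partial>PiM I (\<lambda>i. distr P (N i) (X i))) = (\<integral>\<omega>. f (\<lambda>i\<in>I. X i \<omega>) \<partial>P)"
proof -
  interpret prob_space P by fact
  have rv: "random_variable (N i) (X i)" if "i \<in> I" for i
    using assms(3) that by (simp add: indep_vars_def)
  show ?thesis
  proof (cases "I = {}")
    case True
    then show ?thesis by (simp add: PiM_empty restrict_def lebesgue_integral_count_space_finite prob_space)
  next
    case False
    have "PiM I (\<lambda>i. distr P (N i) (X i)) = distr P (PiM I N) (\<lambda>\<omega>. \<lambda>i\<in>I. X i \<omega>)"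
      using indep_vars_iff_distr_eq_PiM'[OF False, where M' = N and X = X] rv assms(3) by simp
    then show ?thesis
      using rv assms(4) by (simp add: integral_distr measurable_restrict)
  qed
qed

theorem theorem12:
  fixes n H :: nat
    and M :: "nat \<Rightarrow> ('s, 'a) cimdp"
    and \<F> :: "nat set set"
    and P :: "'w measure"
    and W :: "nat \<Rightarrow> 'w \<Rightarrow> real"
  assumes "\<And>i. i \<in> {1..n} \<Longrightarrow> costly_info_mdp H (M i)"
    and "matroid {1..n} \<F>"
    and "prob_space P"
    and "\<And>i. i \<in> {1..n} \<Longrightarrow> water_draining_surrogate P (M i) (W i)"
    and "prob_space.indep_vars P (\<lambda>_. borel) W {1..n}"
  shows "OPT n M \<F> \<le> (\<integral>\<omega>. Max ((\<lambda>S. \<Sum>i\<in>S. W i \<omega>) ` \<F>) \<partial>P)"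
proof (rule field_le_epsilon)
  fix e :: real assume "e > 0"
  interpret prob_space P by fact
  \<comment> \<open>Exchanging \<open>n\<close> coordinates costs \<open>n * \<epsilon>\<close>,
    which may be at most \<open>e\<close>; the denominator \<open>n + 1\<close> also serves
    \<open>n = 0\<close>.\<close>
  define \<epsilon> where "\<epsilon> = e / (n + 1)"
  have "\<epsilon> > 0" "n * \<epsilon> \<le> e" using \<open>e > 0\<close> by (simp_all add: \<epsilon>_def field_simps)
  have sub: "\<F> \<subseteq> Pow {1..n}" and empty: "{} \<in> \<F>"
    and down: "\<And>S T. S \<in> \<F> \<Longrightarrow> T \<subseteq> S \<Longrightarrow> T \<in> \<F>"
    using assms(2) unfolding matroid_def by blast+
  have fin: "finite \<F>" using sub by (rule finite_subset) simp
  have fin_S: "finite S" if "S \<in> \<F>" for S using sub that by (auto intro: finite_subset)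
  obtain b' where b': "\<And>i. i \<in> {1..n} \<Longrightarrow> 0 \<le> b' i"
    "\<And>i s. i \<in> {1..n} \<Longrightarrow> s \<in> terminals (M i) \<Longrightarrow> val (M i) s \<le> b' i"
    using exists_val_bound[OF assms(1)] by metis
  \<comment> \<open>The sum of the nonnegative bounds is one bound for all MDPs, so a single
    \<open>m\<close> serves them all.\<close>
  define b where "b = (\<Sum>i=1..n. b' i)"
  have "0 \<le> b" unfolding b_def using b'(1) by (rule sum_nonneg)
  have b: "val (M i) s \<le> b" if "i \<in> {1..n}" "s \<in> terminals (M i)" for i s
    using b'(2)[OF that] member_le_sum[of i "{1..n}" b'] b'(1) that(1) unfolding b_def by fastforce
  obtain m :: nat where "b / \<epsilon> \<le> m" using real_arch_simple by blast
  then have m: "b \<le> m * \<epsilon>" using \<open>\<epsilon> > 0\<close> by (simp add: field_simps)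
  have "\<exists>D. grid_surrogate \<epsilon> m (M i) s D" if "i \<in> {1..n}" for i s
    using b[OF that] by (intro exists_grid_surrogate[OF assms(1)[OF that] \<open>\<epsilon> > 0\<close> _ \<open>0 \<le> b\<close> m])
  then obtain D where D: "\<And>i s. i \<in> {1..n} \<Longrightarrow> grid_surrogate \<epsilon> m (M i) s (D i s)"
    by metis
  have start: "start (M i) \<in> states (M i)" if "i \<in> {1..n}" for i
    using assms(1)[OF that] by (simp add: costly_info_mdp_def)

  \<comment> \<open>Positive parts are integrable by the surrogate identity at \<open>y = 0\<close>,
    inherit independence, and leave the maximum unchanged by
    \<open>Max_sum_positive_part\<close>.\<close>
  define X where "X i \<omega> = max 0 (W i \<omega>)" for i \<omega>
  define \<mu> where "\<mu> i = distr P borel (X i)" for i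
  have X: "integrable P (X i)" if "i \<in> {1..n}" for i
    using assms(4)[OF that]
    unfolding water_draining_surrogate_def X_def has_bochner_integral_iff by blast
  have rv: "X i \<in> borel_measurable P" if "i \<in> {1..n}" for i
    using X[OF that] by simp
  have indep: "indep_vars (\<lambda>_. borel) X {1..n}"
    unfolding X_def by (rule indep_vars_compose2[OF assms(5)]) simp

  have "utility M \<pi> (\<lambda>i. start (M i)) \<le> (\<integral>\<omega>. Max ((\<lambda>S. \<Sum>i\<in>S. W i \<omega>) ` \<F>) \<partial>P) + e"
    if "admissible n M \<F> \<pi> (\<lambda>i. start (M i)) {}" for \<pi>
  proof -
    have "utility M \<pi> (\<lambda>i. start (M i)) \<le>
        measure_pmf.expectation (Pi_pmf {1..n} 0 (\<lambda>i. D i (start (M i))))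
          (max_sum (contraction \<F> {}) (\<lambda>_. 0) {1..n})"
      using assms(1) fin \<open>\<epsilon> > 0\<close> D that empty start by (intro utility_le) auto
    also have "contraction \<F> {} = \<F>" by (simp add: contraction_def)
    also have "measure_pmf.expectation (Pi_pmf {1..n} 0 (\<lambda>i. D i (start (M i))))
        (max_sum \<F> (\<lambda>_. 0) {1..n}) \<le>
        (\<integral>w. max_sum \<F> (\<lambda>_. 0) {1..n} w \<partial>PiM {1..n} \<mu>) + card {1..n} * \<epsilon>"
    proof (rule expectation_max_sum_le)
      fix i assume i: "i \<in> {1..n}"
      show "finite (set_pmf (D i (start (M i))))"
        using grid_surrogate_finite[OF D[OF i]] .
      show "prob_space (\<mu> i)" unfolding \<mu>_def using rv[OF i] by (rule prob_space_distr)
      show "integrable (\<mu> i) (\<lambda>v. v)"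
        unfolding \<mu>_def using X[OF i] rv[OF i] by (simp add: integrable_distr_eq)
      show "measure_pmf.expectation (D i (start (M i))) (\<lambda>v. max y v) \<le>
          (\<integral>v. max y v \<partial>\<mu> i) + \<epsilon>" for y
        using grid_surrogate_start_le[OF assms(1)[OF i] assms(4)[OF i] assms(3) \<open>\<epsilon> > 0\<close> D[OF i]]
          rv[OF i] unfolding \<mu>_def by (simp add: integral_distr X_def)
    qed (use fin empty \<open>\<epsilon> > 0\<close> in auto)
    also have "(\<integral>w. max_sum \<F> (\<lambda>_. 0) {1..n} w \<partial>PiM {1..n} \<mu>) =
        (\<integral>\<omega>. max_sum \<F> (\<lambda>_. 0) {1..n} (\<lambda>i\<in>{1..n}. X i \<omega>) \<partial>P)"
      unfolding \<mu>_def
    proof (rule integral_indep_vars[OF assms(3) _ indep])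
      show "max_sum \<F> (\<lambda>_. 0) {1..n} \<in> borel_measurable (Pi\<^sub>M {1..n} (\<lambda>_. borel))"
        unfolding max_sum_def using fin
        by (intro borel_measurable_Max borel_measurable_add borel_measurable_sum) auto
    qed simp
    also have "\<dots> = (\<integral>\<omega>. Max ((\<lambda>S. \<Sum>i\<in>S. W i \<omega>) ` \<F>) \<partial>P)"
    proof (intro Bochner_Integration.integral_cong refl)
      fix \<omega>
      have "(\<Sum>i\<in>S \<inter> {1..n}. (\<lambda>i\<in>{1..n}. X i \<omega>) i) = (\<Sum>i\<in>S. max 0 (W i \<omega>))" if "S \<in> \<F>" for S
      proof -
        have "S \<subseteq> {1..n}" using sub that by blast
        then show ?thesis by (intro sum.cong) (auto simp: X_def)
      qed
      then have "max_sum \<F> (\<lambda>_. 0) {1..n} (\<lambda>i\<in>{1..n}. X i \<omega>) =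
          Max ((\<lambda>S. \<Sum>i\<in>S. max 0 (W i \<omega>)) ` \<F>)"
        unfolding max_sum_def by (intro arg_cong[where f = Max] image_cong) auto
      also have "\<dots> = Max ((\<lambda>S. \<Sum>i\<in>S. W i \<omega>) ` \<F>)"
        using fin empty fin_S down by (rule Max_sum_positive_part)
      finally show "max_sum \<F> (\<lambda>_. 0) {1..n} (\<lambda>i\<in>{1..n}. X i \<omega>) = \<dots>" .
    qed
    finally show ?thesis using \<open>n * \<epsilon> \<le> e\<close> by simp
  qed
  \<comment> \<open>The set of admissible policies is nonempty, so a bound on every utility bounds
    the supremum.\<close>
  moreover have "Stop \<in> {\<pi>. admissible n M \<F> \<pi> (\<lambda>i. start (M i)) {}}" by simp
  ultimately show "OPT n M \<F> \<le> (\<integral>\<omega>. Max ((\<lambda>S. \<Sum>i\<in>S. W i \<omega>) ` \<F>) \<partial>P) + e"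
    unfolding OPT_def by (intro cSUP_least) blast+
qed

end
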